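(* Let $n\geqslant 2$ be an integer. The monoid $\mathcal{PIO}_{n}^-$ is defined by the presentation $\langle A\cup E\cup F\mid R\rangle$ on the $3n-3$ generators $A=\{a_1,\ldots,a_{n-1}\}$, $E=\{e_1,\ldots,e_{n-1}\}$, $F=\{f_2,\ldots,f_n\}$ and the $\frac{1}{2}(5n^2+9n-20)$ relations $R=R_1\cup R_2\cup R_3\cup R_4\cup R_5\cup R_6$, where: $(R_1)$ $a_ia_{n-1}=a_i$ for $1\leqslant i\leqslant n-1$; $a_ia_j=a_{j+1}a_i$ for $1\leqslant i\leqslant j\leqslant n-2$. $(R_2)$ $e_i^2=e_i$ and $f_{i+1}^2=f_{i+1}$ for $1\leqslant i\leqslant n-1$. $(R_3)$ $e_if_j=f_je_i$ for $2\leqslant j\leqslant i\leqslant n-1$; $e_if_{i+1}=f_{i+1}e_i=e_1f_n$ for $1\leqslant i\leqslant n-1$; $e_ie_{i+1}=e_{i+1}e_i=e_i$ for $1\leqslant i\leqslant n-2$; $f_if_{i+1}=f_{i+1}f_i=f_{i+1}$ for $2\leqslant i\leqslant n-1$. $(R_4)$ $a_ie_{i-1}=e_{i-1}$ for $2\leqslant i\leqslant n-1$; $a_ie_j=e_{j+1}a_i$ for $1\leqslant i\leqslant j\leqslant n-2$; $a_{n-1}e_{n-1}=a_{n-1}$; $e_ia_i=e_i$ for $1\leqslant i\leqslant n-1$. $(R_5)$ $a_if_j=f_ja_i$ for $2\leqslant j\leqslant i\leqslant n-1$; $a_if_j=f_{j+1}a_i$ for $1\leqslant i<j\leqslant n-1$;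 $a_1f_n=e_1f_n$ and $a_{n-1}f_n=e_1f_n$. $(R_6)$ $f_{i+1}a_i=f_{i+1}a_1$ for $2\leqslant i\leqslant n-1$.
   Context: $\Omega_n=\{1,\ldots,n\}$ with its natural order. A partial transformation of $\Omega_n$ is a map $\alpha$ from a subset $\operatorname{Dom}(\alpha)\subseteq\Omega_n$ (possibly empty) into $\Omega_n$, with image $\operatorname{Im}(\alpha)$. Maps are written on the right and composed from left to right: $x(\alpha\beta)=(x\alpha)\beta$, with $\operatorname{Dom}(\alpha\beta)=\{x\in\operatorname{Dom}(\alpha)\mid x\alpha\in\operatorname{Dom}(\beta)\}$. $\alpha$ is order-preserving if $x\leqslant y$ implies $x\alpha\leqslant y\alpha$ for all $x,y\in\operatorname{Dom}(\alpha)$, and order-decreasing if $x\alpha\leqslant x$ for all $x\in\operatorname{Dom}(\alpha)$. A subset $I\subseteq\Omega_n$ (possibly empty) is an interval if for all $x,y,z\in\Omega_n$, $x\leqslant y\leqslant z$ and $x,z\in I$ imply $y\in I$. $\mathcal{PIO}_n$ is the monoid, under composition, of all order-preserving partial transformations $\alpha$ of $\Omega_n$ such that $\operatorname{Dom}(\alpha)$ and $\operatorname{Im}(\alpha)$ are both intervals of $\Omega_n$ (it includes the empty transformation), and $\mathcal{PIO}_n^-$ is its submonoid of order-decreasing elements. For an alphabet $X$, $X^*$ is the free monoid on $X$. For $R\subseteq X^*\times X^*$ (a pair $(u,v)\in R$ being written $u=v$), $\sim_R$ is the smallest congruence on $X^*$ containing $R$. A monoid $M$ is defined by the presentation $\langle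 X\mid R\rangle$ if $M$ is isomorphic to $X^*/{\sim_R}$. In the presentation, the elements of $A\cup E\cup F$ are regarded as $3n-3$ distinct formal letters. (They are named after generators of $\mathcal{PIO}_n^-$: for $1\leqslant i\leqslant n-1$, $a_i$ is the full transformation with $xa_i=x$ for $x\leqslant i$ and $xa_i=x-1$ for $x\geqslant i+1$; $e_i$ is the identity map on $\{1,\ldots,i\}$; $f_{i+1}$ is the identity map on $\{i+1,\ldots,n\}$.) The number of relations is counted as listed, a chain $u=v=w$ counting as two relations. *)

theory Defs
  imports "HOL-Algebra.Group"
begin

definition free_monoid :: "'x set \<Rightarrow> 'x list monoid" where
  "free_monoid X = \<lparr>carrier = lists X, mult = (@), one = []\<rparr>"

definition congruence_on :: "('a, 'b) monoid_scheme \<Rightarrow> 'a rel \<Rightarrow> bool" where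
  "congruence_on M C \<longleftrightarrow> equiv (carrier M) C \<and>
     (\<forall>(x, x') \<in> C. \<forall>(y, y') \<in> C. (x \<otimes>\<^bsub>M\<^esub> y, x' \<otimes>\<^bsub>M\<^esub> y') \<in> C)"

definition generated_congruence :: "('a, 'b) monoid_scheme \<Rightarrow> 'a rel \<Rightarrow> 'a rel" where
  "generated_congruence M R = \<Inter> {C. congruence_on M C \<and> R \<subseteq> C}"

text \<open>For a congruence \<open>C\<close>, the union in the product below is the single class of
  \<open>x \<otimes> y\<close>, for any representatives \<open>x\<close> and \<open>y\<close>.\<close>

definition quotient_monoid :: "('a, 'b) monoid_scheme \<Rightarrow> 'a rel \<Rightarrow> 'a set monoid" where
  "quotient_monoid M C =
     \<lparr>carrier = carrier M // C,
      mult = (\<lambda>U V. \<Union>x\<in>U. \<Union>y\<in>V. C `` {x \<otimes>\<^bsub>M\<^esub> y}),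
      one = C `` {\<one>\<^bsub>M\<^esub>}\<rparr>"

text \<open>The relations form a list, so that they can be counted with repetitions.\<close>

definition presented_monoid :: "'x set \<Rightarrow> ('x list \<times> 'x list) list \<Rightarrow> 'x list set monoid" where
  "presented_monoid X rs =
     quotient_monoid (free_monoid X) (generated_congruence (free_monoid X) (set rs))"

definition defined_by_presentation ::
  "('a, 'b) monoid_scheme \<Rightarrow> 'x set \<Rightarrow> ('x list \<times> 'x list) list \<Rightarrow> bool" where
  "defined_by_presentation M X rs \<longleftrightarrow>
     set rs \<subseteq> lists X \<times> lists X \<and> M \<cong> presented_monoid X rs"

definition interval_of :: "nat \<Rightarrow> nat set \<Rightarrow> bool" where
  "interval_of n I \<longleftrightarrow> I \<subseteq> {1..n} \<and>
     (\<forall>x\<in>{1..n}. \<forall>y\<in>{1..n}. \<forall>z\<in>{1..n}. x \<le> y \<and> y \<le> z \<and> x \<in> I \<and> z \<in> I \<longrightarrow> y \<in> I)"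

definition order_preserving :: "(nat \<rightharpoonup> nat) \<Rightarrow> bool" where
  "order_preserving \<alpha> \<longleftrightarrow> mono_on (dom \<alpha>) (\<lambda>x. the (\<alpha> x))"

definition order_decreasing :: "(nat \<rightharpoonup> nat) \<Rightarrow> bool" where
  "order_decreasing \<alpha> \<longleftrightarrow> (\<forall>x\<in>dom \<alpha>. the (\<alpha> x) \<le> x)"

text \<open>Maps act on the right, so the product \<open>\<alpha>\<beta>\<close> (first \<open>\<alpha>\<close>, then \<open>\<beta>\<close>) is
  \<open>\<beta> \<circ>\<^sub>m \<alpha>\<close>.\<close>

definition PIO :: "nat \<Rightarrow> (nat \<rightharpoonup> nat) monoid" where
  "PIO n =
     \<lparr>carrier = {\<alpha>. interval_of n (dom \<alpha>) \<and> interval_of n (ran \<alpha>) \<and> order_preserving \<alpha>},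
      mult = (\<lambda>\<alpha> \<beta>. \<beta> \<circ>\<^sub>m \<alpha>),
      one = Some |` {1..n}\<rparr>"

definition PIO_decreasing :: "nat \<Rightarrow> (nat \<rightharpoonup> nat) monoid" where
  "PIO_decreasing n = (PIO n)\<lparr>carrier := {\<alpha> \<in> carrier (PIO n). order_decreasing \<alpha>}\<rparr>"

datatype letter = gen_a nat | gen_e nat | gen_f nat

definition letters_A :: "nat \<Rightarrow> letter set" where
  "letters_A n = gen_a ` {1..n - 1}"

definition letters_E :: "nat \<Rightarrow> letter set" where
  "letters_E n = gen_e ` {1..n - 1}"

definition letters_F :: "nat \<Rightarrow> letter set" where
  "letters_F n = gen_f ` {2..n}"

type_synonym relations = "(letter list \<times> letter list) list"

definition R1 :: "nat \<Rightarrow> relations" where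
  "R1 n =
     [([gen_a i, gen_a (n - 1)], [gen_a i]). i \<leftarrow> [1..<n]]
   @ [([gen_a i, gen_a j], [gen_a (j + 1), gen_a i]). i \<leftarrow> [1..<n - 1], j \<leftarrow> [i..<n - 1]]"

definition R2 :: "nat \<Rightarrow> relations" where
  "R2 n =
     [([gen_e i, gen_e i], [gen_e i]). i \<leftarrow> [1..<n]]
   @ [([gen_f (i + 1), gen_f (i + 1)], [gen_f (i + 1)]). i \<leftarrow> [1..<n]]"

text \<open>A chain \<open>u = v = w\<close> is the two relations \<open>u = v\<close> and \<open>v = w\<close>.\<close>

definition R3 :: "nat \<Rightarrow> relations" where
  "R3 n =
     [([gen_e i, gen_f j], [gen_f j, gen_e i]). i \<leftarrow> [2..<n], j \<leftarrow> [2..<i + 1]]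
   @ [([gen_e i, gen_f (i + 1)], [gen_f (i + 1), gen_e i]). i \<leftarrow> [1..<n]]
   @ [([gen_f (i + 1), gen_e i], [gen_e 1, gen_f n]). i \<leftarrow> [1..<n]]
   @ [([gen_e i, gen_e (i + 1)], [gen_e (i + 1), gen_e i]). i \<leftarrow> [1..<n - 1]]
   @ [([gen_e (i + 1), gen_e i], [gen_e i]). i \<leftarrow> [1..<n - 1]]
   @ [([gen_f i, gen_f (i + 1)], [gen_f (i + 1), gen_f i]). i \<leftarrow> [2..<n]]
   @ [([gen_f (i + 1), gen_f i], [gen_f (i + 1)]). i \<leftarrow> [2..<n]]"

definition R4 :: "nat \<Rightarrow> relations" where
  "R4 n =
     [([gen_a i, gen_e (i - 1)], [gen_e (i - 1)]). i \<leftarrow> [2..<n]]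
   @ [([gen_a i, gen_e j], [gen_e (j + 1), gen_a i]). i \<leftarrow> [1..<n - 1], j \<leftarrow> [i..<n - 1]]
   @ [([gen_a (n - 1), gen_e (n - 1)], [gen_a (n - 1)])]
   @ [([gen_e i, gen_a i], [gen_e i]). i \<leftarrow> [1..<n]]"

definition R5 :: "nat \<Rightarrow> relations" where
  "R5 n =
     [([gen_a i, gen_f j], [gen_f j, gen_a i]). i \<leftarrow> [2..<n], j \<leftarrow> [2..<i + 1]]
   @ [([gen_a i, gen_f j], [gen_f (j + 1), gen_a i]). i \<leftarrow> [1..<n], j \<leftarrow> [i + 1..<n]]
   @ [([gen_a 1, gen_f n], [gen_e 1, gen_f n]),
      ([gen_a (n - 1), gen_f n], [gen_e 1, gen_f n])]"

definition R6 :: "nat \<Rightarrow> relations" where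
  "R6 n = [([gen_f (i + 1), gen_a i], [gen_f (i + 1), gen_a 1]). i \<leftarrow> [2..<n]]"

definition PIO_relations :: "nat \<Rightarrow> relations" where
  "PIO_relations n = R1 n @ R2 n @ R3 n @ R4 n @ R5 n @ R6 n"

end

theory Submission
  imports Defs
begin

text \<open>
  A nonempty element of \<open>PIO_decreasing n\<close> has an interval \<open>{p..q}\<close> as its domain.  It sends \<open>p\<close> to
  some \<open>p - k\<close> with \<open>k < p\<close>, and, because its image is an interval as well, each step from \<open>t\<close> to
  \<open>t + 1\<close> raises the value by \<open>0\<close> or \<open>1\<close>.  Such an element is therefore coded by \<open>p\<close>, \<open>q\<close>, \<open>k\<close> and
  the set \<open>T \<subseteq> {p..<q}\<close> of the points after which the value stays constant, and all these codes
  occur.  The word \<open>f\<^sub>p e\<^sub>q a\<^sub>t \<dots> a\<^sub>u a\<^sub>1\<^sup>k\<close>, where \<open>t > \<dots> > u\<close> are the elements of \<open>T\<close> and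
  where \<open>f\<^sub>1\<close> and \<open>e\<^sub>n\<close> are omitted, represents the element with this code, and \<open>e\<^sub>1 f\<^sub>n\<close> represents
  the empty map.  Evaluation of words is thus a bijection from these normal words onto the monoid
  (\<open>inj_on_normal_words\<close>, \<open>word_map_image\<close>).

  The relations hold in the monoid (\<open>word_map_PIO_relations\<close>), so it remains to see that they
  suffice to turn every word into a normal word (\<open>product_eq_normal_word\<close>).  They make \<open>e\<^sub>1 f\<^sub>n\<close> a
  zero, and they allow every \<open>f\<close> to be moved to the front and every \<open>e\<close> next to it, with indices
  that may increase when an \<open>a\<^sub>i\<close> is passed; there the
  \<open>f\<close>'s combine to the one of largest index, the \<open>e\<close>'s to the one of smallest index, and an
  \<open>e\<^sub>q f\<^sub>p\<close> with \<open>q < p\<close> is zero.  This leaves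
  \<open>f\<^sub>p e\<^sub>q a\<^sub>i a\<^sub>j \<dots>\<close> with \<open>p \<le> q\<close> (\<open>product_in_restricted_shifts\<close>).  The relations between the
  \<open>a\<close>'s sort their indices into strictly decreasing order (\<open>A_decreasing\<close>); indices at least \<open>q\<close>
  are absorbed by \<open>e\<^sub>q\<close> (\<open>E_A_filter\<close>); and the indices below \<open>p\<close>, which collapse points outside
  the domain and so act on it as translations by \<open>-1\<close>, can all be replaced by \<open>1\<close> (\<open>F_A_below\<close>).

  The calculations with the relations take place in an arbitrary monoid type that satisfies them.
  They are transferred to words by letting words act on the congruence classes, which represents
  the presented monoid faithfully by self-maps (\<open>word_action_eq_iff\<close>).
\<close>

section \<open>Presentations of monoids\<close>

lemma carrier_free_monoid [simp]: "carrier (free_monoid X) = lists X"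
  and mult_free_monoid [simp]: "u \<otimes>\<^bsub>free_monoid X\<^esub> v = u @ v"
  by (simp_all add: free_monoid_def)

lemma generated_congruence_least:
  "congruence_on M C \<Longrightarrow> R \<subseteq> C \<Longrightarrow> generated_congruence M R \<subseteq> C"
  by (auto simp: generated_congruence_def)

lemma subset_generated_congruence: "R \<subseteq> generated_congruence M R"
  by (auto simp: generated_congruence_def)

lemma congruence_on_generated_congruence:
  assumes closed: "\<And>x y. x \<in> carrier M \<Longrightarrow> y \<in> carrier M \<Longrightarrow> x \<otimes>\<^bsub>M\<^esub> y \<in> carrier M"
    and R: "R \<subseteq> carrier M \<times> carrier M"
  shows "congruence_on M (generated_congruence M R)"
proof -
  let ?G = "generated_congruence M R"
  have total: "congruence_on M (carrier M \<times> carrier M)"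
    using closed by (auto simp: congruence_on_def equiv_def refl_on_def sym_def trans_def)
  have sub: "?G \<subseteq> carrier M \<times> carrier M"
    using total R by (rule generated_congruence_least)
  have "refl_on (carrier M) ?G"
    by (auto simp: generated_congruence_def congruence_on_def equiv_def refl_on_def)
  moreover have "sym ?G"
    unfolding generated_congruence_def congruence_on_def equiv_def
    by (intro symI) (auto dest: symD)
  moreover have "trans ?G"
    unfolding generated_congruence_def congruence_on_def equiv_def
    by (intro transI) (blast dest: transD)
  moreover have "\<forall>(x, x') \<in> ?G. \<forall>(y, y') \<in> ?G. (x \<otimes>\<^bsub>M\<^esub> y, x' \<otimes>\<^bsub>M\<^esub> y') \<in> ?G"
    by (clarsimp simp: generated_congruence_def congruence_on_def) blast
  ultimately show ?thesis
    using sub by (simp add: congruence_on_def equiv_def)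
qed

lemma congruence_on_word_congruence:
  assumes "set rs \<subseteq> lists X \<times> lists X"
  shows "congruence_on (free_monoid X) (generated_congruence (free_monoid X) (set rs))"
  using assms by (intro congruence_on_generated_congruence) auto

text \<open>
  The relations hold under \<open>\<phi>\<close>, so the generated congruence \<open>C\<close> lies in the kernel of \<open>\<phi>\<close>.
  Conversely, two words with equal images have normal forms in \<open>N\<close> with equal images, and these
  coincide by injectivity; so \<open>C\<close> is the kernel, and the isomorphism sends an element of \<open>M\<close> to its
  fibre under \<open>\<phi>\<close>.
\<close>

lemma presentation_criterion:
  fixes M :: "('a, 'b) monoid_scheme" and X :: "'x set" and rs :: "('x list \<times> 'x list) list"
    and \<phi> :: "'x list \<Rightarrow> 'a"
  defines "C \<equiv> generated_congruence (free_monoid X) (set rs)"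
  assumes rs: "set rs \<subseteq> lists X \<times> lists X"
    and hom: "\<And>u v. u \<in> lists X \<Longrightarrow> v \<in> lists X \<Longrightarrow> \<phi> (u @ v) = \<phi> u \<otimes>\<^bsub>M\<^esub> \<phi> v"
    and sound: "\<And>u v. (u, v) \<in> set rs \<Longrightarrow> \<phi> u = \<phi> v"
    and N: "N \<subseteq> lists X"
    and normal: "\<And>w. w \<in> lists X \<Longrightarrow> \<exists>v\<in>N. (w, v) \<in> C"
    and inj: "inj_on \<phi> N"
    and image: "\<phi> ` N = carrier M"
  shows "defined_by_presentation M X rs"
proof -
  define K where "K = {(u, v). u \<in> lists X \<and> v \<in> lists X \<and> \<phi> u = \<phi> v}"
  have C: "congruence_on (free_monoid X) C"
    unfolding C_def using rs by (rule congruence_on_word_congruence)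
  have "congruence_on (free_monoid X) K"
    by (auto simp: congruence_on_def K_def equiv_def refl_on_def sym_def trans_def hom)
  then have CK: "C \<subseteq> K"
    unfolding C_def using rs sound by (intro generated_congruence_least) (auto simp: K_def)
  have KC: "K \<subseteq> C"
  proof clarify
    fix u v assume "(u, v) \<in> K"
    then have uv: "u \<in> lists X" "v \<in> lists X" "\<phi> u = \<phi> v" by (auto simp: K_def)
    obtain u' v' where u': "u' \<in> N" "(u, u') \<in> C" and v': "v' \<in> N" "(v, v') \<in> C"
      using normal uv by meson
    have "(u, u') \<in> K" "(v, v') \<in> K" using CK u' v' by auto
    then have "\<phi> u' = \<phi> v'" using uv by (simp add: K_def)
    then have "u' = v'" using inj u' v' by (auto dest: inj_onD)
    then show "(u, v) \<in> C"
      using u' v' C unfolding congruence_on_def equiv_def by (meson symD transD)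
  qed
  have CK: "C = K" using CK KC by blast
  have im: "\<phi> ` lists X = carrier M"
  proof -
    have "\<exists>v\<in>N. \<phi> w = \<phi> v" if "w \<in> lists X" for w
      using normal[OF that] by (auto simp: CK K_def)
    then have "\<phi> ` lists X \<subseteq> \<phi> ` N" by (metis image_eqI image_subsetI)
    moreover have "\<phi> ` N \<subseteq> \<phi> ` lists X" using N by (rule image_mono)
    ultimately show ?thesis using image by simp
  qed
  have rep: "\<exists>w. w \<in> lists X \<and> \<phi> w = m" if "m \<in> carrier M" for m
    using that unfolding im[symmetric] by blast
  define h where "h m = {w \<in> lists X. \<phi> w = m}" for m
  have class_eq: "C `` {w} = h (\<phi> w)" if "w \<in> lists X" for w
    using that by (auto simp: CK K_def h_def)
  have mult: "h (m \<otimes>\<^bsub>M\<^esub> m') = (\<Union>x\<in>h m. \<Union>y\<in>h m'. C `` {x @ y})"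
    if m: "m \<in> carrier M" "m' \<in> carrier M" for m m'
  proof -
    obtain u v where uv: "u \<in> lists X" "\<phi> u = m" "v \<in> lists X" "\<phi> v = m'"
      using rep[OF m(1)] rep[OF m(2)] by blast
    have "C `` {x @ y} = h (m \<otimes>\<^bsub>M\<^esub> m')" if "x \<in> h m" "y \<in> h m'" for x y
      using that class_eq[of "x @ y"] hom[of x y] by (simp add: h_def)
    moreover have "u \<in> h m" "v \<in> h m'" using uv by (auto simp: h_def)
    ultimately show ?thesis by blast
  qed
  have bij: "bij_betw h (carrier M) (lists X // C)"
  proof (rule bij_betwI')
    show "(h x = h y) = (x = y)" if x: "x \<in> carrier M" for x y
    proof -
      obtain w where "w \<in> lists X" "\<phi> w = x" using rep[OF x] by blast
      then show ?thesis unfolding h_def by blast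
    qed
    show "h x \<in> lists X // C" if x: "x \<in> carrier M" for x
    proof -
      obtain w where "w \<in> lists X" "\<phi> w = x" using rep[OF x] by blast
      then show ?thesis using class_eq by (metis quotientI)
    qed
    show "\<exists>x\<in>carrier M. y = h x" if y: "y \<in> lists X // C" for y
    proof -
      obtain w where "w \<in> lists X" "y = C `` {w}" using y by (rule quotientE)
      then show ?thesis using class_eq im by blast
    qed
  qed
  have "h \<in> iso M (presented_monoid X rs)"
    using bij mult
    by (auto simp: iso_def hom_def presented_monoid_def quotient_monoid_def C_def[symmetric]
        dest: bij_betwE)
  then show ?thesis
    using rs by (auto simp: defined_by_presentation_def is_iso_def)
qed

section \<open>Faithful action of words modulo a congruence\<close>

text \<open>
  The quotient of the free monoid depends on terms, so it is not itself a type of class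
  \<^class>\<open>monoid_mult\<close>.  As in Cayley's theorem it embeds into the monoid of self-maps of its
  carrier, and equality of such self-maps turns equational reasoning modulo a congruence into
  ordinary equational reasoning.
\<close>

typedef 'a self_map = "UNIV :: ('a \<Rightarrow> 'a) set"
  morphisms apply_self_map Self_map by simp

setup_lifting type_definition_self_map

instantiation self_map :: (type) monoid_mult
begin

lift_definition one_self_map :: "'a self_map" is id .
lift_definition times_self_map :: "'a self_map \<Rightarrow> 'a self_map \<Rightarrow> 'a self_map" is "(\<circ>)" .

instance by standard (transfer; simp add: fun_eq_iff)+

end

text \<open>
  Sets of words that are not congruence classes are fixed, so that congruent words have equal
  actions on them as well, even when one of the words is empty.
\<close>

definition letter_action :: "'x set \<Rightarrow> 'x list rel \<Rightarrow> 'x \<Rightarrow> 'x list set self_map" where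
  "letter_action X C x =
     Self_map (\<lambda>V. if V \<in> lists X // C then \<Union>v\<in>V. C `` {x # v} else V)"

lemma apply_self_map_one: "apply_self_map 1 V = V"
  by transfer simp

lemma apply_self_map_times: "apply_self_map (s * t) V = apply_self_map s (apply_self_map t V)"
  by transfer simp

lemma word_action_class:
  assumes C: "congruence_on (free_monoid X) C" and "w \<in> lists X" "v \<in> lists X"
  shows "apply_self_map (prod_list (map (letter_action X C) w)) (C `` {v}) = C `` {w @ v}"
  using assms(2)
proof induction
  case Nil
  then show ?case by (simp add: apply_self_map_one)
next
  case (Cons x w)
  have eq: "equiv (lists X) C" using C by (simp add: congruence_on_def)
  have in_X: "x # w @ v \<in> lists X" "w @ v \<in> lists X"
    using Cons.prems Cons.hyps assms(3) by simp_all
  have "C `` {x # y} = C `` {x # w @ v}" if "y \<in> C `` {w @ v}" for y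
  proof -
    have "([x], [x]) \<in> C" "(w @ v, y) \<in> C"
      using eq Cons.hyps that by (simp_all add: equiv_def refl_on_def)
    then have "([x] @ w @ v, [x] @ y) \<in> C"
      using C by (fastforce simp: congruence_on_def)
    then show ?thesis using equiv_class_eq[OF eq] by fastforce
  qed
  moreover have "w @ v \<in> C `` {w @ v}" using eq in_X(2) by (rule equiv_class_self)
  ultimately have "(\<Union>y\<in>C `` {w @ v}. C `` {x # y}) = C `` {x # w @ v}" by blast
  then show ?case
    using Cons in_X by (simp add: apply_self_map_times letter_action_def Self_map_inverse quotientI)
qed

lemma word_action_other:
  assumes "V \<notin> lists X // C"
  shows "apply_self_map (prod_list (map (letter_action X C) w)) V = V"
  using assms by (induction w)
    (auto simp: apply_self_map_one apply_self_map_times letter_action_def Self_map_inverse)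

text \<open>
  The action is faithful because a word sends the class of the empty word to its own class.
\<close>

lemma word_action_eq_iff:
  assumes C: "congruence_on (free_monoid X) C" and uv: "u \<in> lists X" "v \<in> lists X"
  shows "prod_list (map (letter_action X C) u) = prod_list (map (letter_action X C) v)
     \<longleftrightarrow> (u, v) \<in> C" (is "?s = ?t \<longleftrightarrow> _")
proof
  have eq: "equiv (lists X) C" using C by (simp add: congruence_on_def)
  assume "?s = ?t"
  then have "C `` {u} = C `` {v}"
    using word_action_class[OF C, of _ "[]"] uv by (metis append_Nil2 lists.Nil)
  then show "(u, v) \<in> C" using eq uv by (simp add: eq_equiv_class_iff)
next
  have eq: "equiv (lists X) C" using C by (simp add: congruence_on_def)
  assume "(u, v) \<in> C"
  have "apply_self_map ?s V = apply_self_map ?t V" for V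
  proof (cases "V \<in> lists X // C")
    case True
    then obtain w where w: "w \<in> lists X" "V = C `` {w}" by (rule quotientE)
    have "(w, w) \<in> C" using eq w by (auto simp: equiv_def refl_on_def)
    then have "(u @ w, v @ w) \<in> C"
      using C \<open>(u, v) \<in> C\<close> by (fastforce simp: congruence_on_def)
    then show ?thesis
      using eq w uv by (simp add: word_action_class[OF C] equiv_class_eq)
  next
    case False
    then show ?thesis by (simp add: word_action_other)
  qed
  then show "?s = ?t" by (metis apply_self_map_inject ext)
qed

section \<open>Normal forms of products of generators\<close>

abbreviation letters :: "nat \<Rightarrow> letter set" where
  "letters n \<equiv> letters_A n \<union> letters_E n \<union> letters_F n"

text \<open>
  The codes of the nonempty maps, with \<open>f\<^sub>1\<close> and \<open>e\<^sub>n\<close>, which would stand for the identity, left out.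
  The indices in \<open>T\<close> have to decrease: an \<open>a\<^sub>t\<close> that acts first moves only points above \<open>t\<close>, and
  moves them to no point below \<open>t\<close>, hence leaves the later collapses at smaller indices unaffected.
\<close>

definition normal_word :: "nat \<Rightarrow> nat \<Rightarrow> nat \<Rightarrow> nat set \<Rightarrow> nat \<Rightarrow> letter list" where
  "normal_word n p q T k =
     (if p \<le> 1 then [] else [gen_f p]) @ (if n \<le> q then [] else [gen_e q]) @
     map gen_a (rev (sorted_list_of_set T)) @ replicate k (gen_a 1)"

definition normal_words :: "nat \<Rightarrow> letter list set" where
  "normal_words n = {[gen_e 1, gen_f n]} \<union>
     {normal_word n p q T k | p q T k. 1 \<le> p \<and> p \<le> q \<and> q \<le> n \<and> T \<subseteq> {p..<q} \<and> k < p}"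

lemma normal_wordsI:
  "1 \<le> p \<Longrightarrow> p \<le> q \<Longrightarrow> q \<le> n \<Longrightarrow> T \<subseteq> {p..<q} \<Longrightarrow> k < p \<Longrightarrow> normal_word n p q T k \<in> normal_words n"
  unfolding normal_words_def by blast

lemma decreasing_list_eq_rev_sorted_list_of_set:
  fixes js :: "'a :: linorder list"
  assumes "sorted_wrt (>) js"
  shows "js = rev (sorted_list_of_set (set js))"
proof -
  have "sorted_wrt (<) (rev js)" using assms by (simp add: sorted_wrt_rev)
  then have "sorted_list_of_set (set (rev js)) = rev js"
    by (metis List.finite_set sorted_list_of_set.sorted_sorted_key_list_of_set
        sorted_list_of_set_sort_remdups strict_sorted_iff sorted_sort_id distinct_remdups_id)
  then show ?thesis by simp
qed

lemma decreasing_list_split: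
  fixes js :: "'a :: linorder list"
  assumes "sorted_wrt (>) js"
  shows "js = filter (\<lambda>j. p \<le> j) js @ filter (\<lambda>j. j < p) js"
  using assms
proof (induction js)
  case (Cons j js)
  show ?case
  proof (cases "p \<le> j")
    case True
    then show ?thesis using Cons by simp
  next
    case False
    then have "filter (\<lambda>i. p \<le> i) js = []" "filter (\<lambda>i. i < p) js = js"
      using Cons.prems by (auto simp: filter_empty_conv filter_id_conv)
    then show ?thesis using False by simp
  qed
qed simp

text \<open>
  Abstract elements \<open>g\<close> in place of the letters, in any monoid in which the relations hold.
\<close>

locale PIO_letters =
  fixes n :: nat and g :: "letter \<Rightarrow> 'm :: monoid_mult"
  assumes n: "2 \<le> n"
    and relations:
      "\<And>u v. (u, v) \<in> set (PIO_relations n) \<Longrightarrow> prod_list (map g u) = prod_list (map g v)"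
begin

abbreviation "a i \<equiv> g (gen_a i)"
abbreviation "e i \<equiv> g (gen_e i)"
abbreviation "f i \<equiv> g (gen_f i)"

text \<open>
  The conventions \<open>F 1 = 1\<close> and \<open>E n = 1\<close> make the laws below uniform in the indices.  Allowing
  \<open>E q = 1\<close> for all \<open>q \<ge> n\<close> makes \<open>E (Suc q)\<close> meaningful without a case distinction.
\<close>

definition F :: "nat \<Rightarrow> 'm" where "F p = (if p \<le> 1 then 1 else f p)"
definition E :: "nat \<Rightarrow> 'm" where "E q = (if n \<le> q then 1 else e q)"
definition A :: "nat list \<Rightarrow> 'm" where "A js = prod_list (map a js)"
definition z :: 'm where "z = e 1 * f n"

lemma relations_a:
  shows "1 \<le> i \<Longrightarrow> i < n \<Longrightarrow> a i * a (n - 1) = a i"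
    and "1 \<le> i \<Longrightarrow> i \<le> j \<Longrightarrow> j < n - 1 \<Longrightarrow> a i * a j = a (j + 1) * a i"
proof -
  show "a i * a (n - 1) = a i" if "1 \<le> i" "i < n"
  proof -
    have 1: "([gen_a i, gen_a (n - 1)], [gen_a i]) \<in> set (PIO_relations n)"
      using that by (force simp: PIO_relations_def R1_def simp del: upt_Suc)
    show ?thesis using relations[OF 1] by (simp add: z_def)
  qed
  show "a i * a j = a (j + 1) * a i" if "1 \<le> i" "i \<le> j" "j < n - 1"
  proof -
    have 1: "([gen_a i, gen_a j], [gen_a (j + 1), gen_a i]) \<in> set (PIO_relations n)"
      using that by (force simp: PIO_relations_def R1_def simp del: upt_Suc)
    show ?thesis using relations[OF 1] by (simp add: z_def)
  qed
qed

lemma relations_idem: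
  shows "1 \<le> i \<Longrightarrow> i < n \<Longrightarrow> e i * e i = e i"
    and "1 \<le> i \<Longrightarrow> i < n \<Longrightarrow> f (i + 1) * f (i + 1) = f (i + 1)"
proof -
  show "e i * e i = e i" if "1 \<le> i" "i < n"
  proof -
    have 1: "([gen_e i, gen_e i], [gen_e i]) \<in> set (PIO_relations n)"
      using that by (force simp: PIO_relations_def R2_def simp del: upt_Suc)
    show ?thesis using relations[OF 1] by (simp add: z_def)
  qed
  show "f (i + 1) * f (i + 1) = f (i + 1)" if "1 \<le> i" "i < n"
  proof -
    have 1: "([gen_f (i + 1), gen_f (i + 1)], [gen_f (i + 1)]) \<in> set (PIO_relations n)"
      using that by (force simp: PIO_relations_def R2_def simp del: upt_Suc)
    show ?thesis using relations[OF 1] by (simp add: z_def)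
  qed
qed

lemma relations_ef:
  shows "2 \<le> j \<Longrightarrow> j \<le> i \<Longrightarrow> i < n \<Longrightarrow> e i * f j = f j * e i"
    and "1 \<le> i \<Longrightarrow> i < n \<Longrightarrow> e i * f (i + 1) = z"
    and "1 \<le> i \<Longrightarrow> i < n \<Longrightarrow> f (i + 1) * e i = z"
    and "1 \<le> i \<Longrightarrow> i < n - 1 \<Longrightarrow> e i * e (i + 1) = e i"
    and "1 \<le> i \<Longrightarrow> i < n - 1 \<Longrightarrow> e (i + 1) * e i = e i"
    and "2 \<le> i \<Longrightarrow> i < n \<Longrightarrow> f i * f (i + 1) = f (i + 1)"
    and "2 \<le> i \<Longrightarrow> i < n \<Longrightarrow> f (i + 1) * f i = f (i + 1)"
proof -
  show "e i * f j = f j * e i" if "2 \<le> j" "j \<le> i" "i < n"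
  proof -
    have 1: "([gen_e i, gen_f j], [gen_f j, gen_e i]) \<in> set (PIO_relations n)"
      using that by (force simp: PIO_relations_def R3_def simp del: upt_Suc)
    show ?thesis using relations[OF 1] by (simp add: z_def)
  qed
  show "e i * f (i + 1) = z" if "1 \<le> i" "i < n"
  proof -
    have 1: "([gen_e i, gen_f (i + 1)], [gen_f (i + 1), gen_e i]) \<in> set (PIO_relations n)"
      using that by (force simp: PIO_relations_def R3_def simp del: upt_Suc)
    have 2: "([gen_f (i + 1), gen_e i], [gen_e 1, gen_f n]) \<in> set (PIO_relations n)"
      using that by (force simp: PIO_relations_def R3_def simp del: upt_Suc)
    show ?thesis using relations[OF 1] relations[OF 2] by (simp add: z_def)
  qed
  show "f (i + 1) * e i = z" if "1 \<le> i" "i < n"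
  proof -
    have 1: "([gen_f (i + 1), gen_e i], [gen_e 1, gen_f n]) \<in> set (PIO_relations n)"
      using that by (force simp: PIO_relations_def R3_def simp del: upt_Suc)
    show ?thesis using relations[OF 1] by (simp add: z_def)
  qed
  show "e i * e (i + 1) = e i" if "1 \<le> i" "i < n - 1"
  proof -
    have 1: "([gen_e i, gen_e (i + 1)], [gen_e (i + 1), gen_e i]) \<in> set (PIO_relations n)"
      using that by (force simp: PIO_relations_def R3_def simp del: upt_Suc)
    have 2: "([gen_e (i + 1), gen_e i], [gen_e i]) \<in> set (PIO_relations n)"
      using that by (force simp: PIO_relations_def R3_def simp del: upt_Suc)
    show ?thesis using relations[OF 1] relations[OF 2] by (simp add: z_def)
  qed
  show "e (i + 1) * e i = e i" if "1 \<le> i" "i < n - 1"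
  proof -
    have 1: "([gen_e (i + 1), gen_e i], [gen_e i]) \<in> set (PIO_relations n)"
      using that by (force simp: PIO_relations_def R3_def simp del: upt_Suc)
    show ?thesis using relations[OF 1] by (simp add: z_def)
  qed
  show "f i * f (i + 1) = f (i + 1)" if "2 \<le> i" "i < n"
  proof -
    have 1: "([gen_f i, gen_f (i + 1)], [gen_f (i + 1), gen_f i]) \<in> set (PIO_relations n)"
      using that by (force simp: PIO_relations_def R3_def simp del: upt_Suc)
    have 2: "([gen_f (i + 1), gen_f i], [gen_f (i + 1)]) \<in> set (PIO_relations n)"
      using that by (force simp: PIO_relations_def R3_def simp del: upt_Suc)
    show ?thesis using relations[OF 1] relations[OF 2] by (simp add: z_def)
  qed
  show "f (i + 1) * f i = f (i + 1)" if "2 \<le> i" "i < n"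
  proof -
    have 1: "([gen_f (i + 1), gen_f i], [gen_f (i + 1)]) \<in> set (PIO_relations n)"
      using that by (force simp: PIO_relations_def R3_def simp del: upt_Suc)
    show ?thesis using relations[OF 1] by (simp add: z_def)
  qed
qed

lemma relations_ae:
  shows "2 \<le> i \<Longrightarrow> i < n \<Longrightarrow> a i * e (i - 1) = e (i - 1)"
    and "1 \<le> i \<Longrightarrow> i \<le> j \<Longrightarrow> j < n - 1 \<Longrightarrow> a i * e j = e (j + 1) * a i"
    and "a (n - 1) * e (n - 1) = a (n - 1)"
    and "1 \<le> i \<Longrightarrow> i < n \<Longrightarrow> e i * a i = e i"
proof -
  show "a i * e (i - 1) = e (i - 1)" if "2 \<le> i" "i < n"
  proof -
    have 1: "([gen_a i, gen_e (i - 1)], [gen_e (i - 1)]) \<in> set (PIO_relations n)"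
      using that by (force simp: PIO_relations_def R4_def simp del: upt_Suc)
    show ?thesis using relations[OF 1] by (simp add: z_def)
  qed
  show "a i * e j = e (j + 1) * a i" if "1 \<le> i" "i \<le> j" "j < n - 1"
  proof -
    have 1: "([gen_a i, gen_e j], [gen_e (j + 1), gen_a i]) \<in> set (PIO_relations n)"
      using that by (force simp: PIO_relations_def R4_def simp del: upt_Suc)
    show ?thesis using relations[OF 1] by (simp add: z_def)
  qed
  show "a (n - 1) * e (n - 1) = a (n - 1)"
  proof -
    have 1: "([gen_a (n - 1), gen_e (n - 1)], [gen_a (n - 1)]) \<in> set (PIO_relations n)"
      by (force simp: PIO_relations_def R4_def simp del: upt_Suc)
    show ?thesis using relations[OF 1] by (simp add: z_def)
  qed
  show "e i * a i = e i" if "1 \<le> i" "i < n"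
  proof -
    have 1: "([gen_e i, gen_a i], [gen_e i]) \<in> set (PIO_relations n)"
      using that by (force simp: PIO_relations_def R4_def simp del: upt_Suc)
    show ?thesis using relations[OF 1] by (simp add: z_def)
  qed
qed

lemma relations_af:
  shows "2 \<le> j \<Longrightarrow> j \<le> i \<Longrightarrow> i < n \<Longrightarrow> a i * f j = f j * a i"
    and "1 \<le> i \<Longrightarrow> i < j \<Longrightarrow> j < n \<Longrightarrow> a i * f j = f (j + 1) * a i"
    and "a 1 * f n = z" and "a (n - 1) * f n = z"
    and "2 \<le> i \<Longrightarrow> i < n \<Longrightarrow> f (i + 1) * a i = f (i + 1) * a 1"
proof -
  show "a i * f j = f j * a i" if "2 \<le> j" "j \<le> i" "i < n"
  proof -
    have 1: "([gen_a i, gen_f j], [gen_f j, gen_a i]) \<in> set (PIO_relations n)"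
      using that by (force simp: PIO_relations_def R5_def simp del: upt_Suc)
    show ?thesis using relations[OF 1] by (simp add: z_def)
  qed
  show "a i * f j = f (j + 1) * a i" if "1 \<le> i" "i < j" "j < n"
  proof -
    have 1: "([gen_a i, gen_f j], [gen_f (j + 1), gen_a i]) \<in> set (PIO_relations n)"
      using that by (force simp: PIO_relations_def R5_def simp del: upt_Suc)
    show ?thesis using relations[OF 1] by (simp add: z_def)
  qed
  show "a 1 * f n = z"
  proof -
    have 1: "([gen_a 1, gen_f n], [gen_e 1, gen_f n]) \<in> set (PIO_relations n)"
      by (force simp: PIO_relations_def R5_def simp del: upt_Suc)
    show ?thesis using relations[OF 1] by (simp add: z_def)
  qed
  show "a (n - 1) * f n = z"
  proof -
    have 1: "([gen_a (n - 1), gen_f n], [gen_e 1, gen_f n]) \<in> set (PIO_relations n)"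
      by (force simp: PIO_relations_def R5_def simp del: upt_Suc)
    show ?thesis using relations[OF 1] by (simp add: z_def)
  qed
  show "f (i + 1) * a i = f (i + 1) * a 1" if "2 \<le> i" "i < n"
  proof -
    have 1: "([gen_f (i + 1), gen_a i], [gen_f (i + 1), gen_a 1]) \<in> set (PIO_relations n)"
      using that by (force simp: PIO_relations_def R6_def simp del: upt_Suc)
    show ?thesis using relations[OF 1] by (simp add: z_def)
  qed
qed

subsection \<open>The idempotents and the zero\<close>

lemma E_E:
  assumes "1 \<le> i" "i \<le> j"
  shows "E i * E j = E i \<and> E j * E i = E i"
  using assms(2)
proof (induction j rule: dec_induct)
  case base
  then show ?case using assms(1) relations_idem(1)[of i] by (simp add: E_def)
next
  case (step j)
  show ?case
  proof (cases "Suc j < n")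
    case True
    have 1: "E j * E (Suc j) = E j" "E (Suc j) * E j = E j"
      using True step.hyps assms(1) relations_ef(4,5)[of j] by (simp_all add: E_def)
    have "E i * E (Suc j) = E i * (E j * E (Suc j))" using step.IH by (simp add: mult.assoc[symmetric])
    moreover have "E (Suc j) * E i = (E (Suc j) * E j) * E i" using step.IH by (simp add: mult.assoc)
    ultimately show ?thesis using 1 step.IH by simp
  qed (simp add: E_def)
qed

lemma F_F:
  assumes "i \<le> j" "j \<le> n"
  shows "F i * F j = F j \<and> F j * F i = F j"
  using assms
proof (induction j rule: dec_induct)
  case base
  then show ?case using relations_idem(2)[of "i - 1"] by (auto simp: F_def)
next
  case (step j)
  show ?case
  proof (cases "j \<ge> 2")
    case True
    have 1: "F j * F (Suc j) = F (Suc j)" "F (Suc j) * F j = F (Suc j)"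
      using True step.prems relations_ef(6,7)[of j] by (simp_all add: F_def)
    have 2: "F i * F j = F j" "F j * F i = F j" using step by auto
    have "F i * F (Suc j) = (F i * F j) * F (Suc j)" using 1 by (simp add: mult.assoc)
    moreover have "F (Suc j) * F i = F (Suc j) * (F j * F i)"
      using 1 by (simp add: mult.assoc[symmetric])
    ultimately show ?thesis using 1 2 by simp
  next
    case False
    then show ?thesis using step.hyps by (simp add: F_def)
  qed
qed

lemma E_F_commute:
  assumes "p \<le> q" shows "E q * F p = F p * E q"
  using assms relations_ef(1)[of p q] by (simp add: E_def F_def)

lemma z_F: "p \<le> n \<Longrightarrow> z * F p = z"
  using F_F[of p n] n by (simp add: z_def F_def mult.assoc split: if_splits)

lemma E_z: "1 \<le> q \<Longrightarrow> E q * z = z"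
  using E_E[of 1 q] n by (simp add: z_def E_def mult.assoc[symmetric] split: if_splits)

text \<open>
  Absorption on the left by an \<open>f\<close> and on the right by an \<open>e\<close> needs the factors of \<open>z\<close> in the
  opposite order, first as \<open>f\<^sub>n e\<^sub>n\<^sub>-\<^sub>1\<close> and then as \<open>f\<^sub>n e\<^sub>1\<close>.
\<close>

lemma z_eq_f_e: "z = f n * e (n - 1)"
  using relations_ef(3)[of "n - 1"] n by simp

lemma F_z: "p \<le> n \<Longrightarrow> F p * z = z"
  using F_F[of p n] n by (simp add: z_eq_f_e F_def mult.assoc[symmetric] split: if_splits)

lemma z_eq_f_e_1: "z = f n * e 1"
proof -
  have "f n * e 1 = F n * (f 2 * e 1)"
    using F_F[of 2 n] n by (simp add: F_def mult.assoc[symmetric])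
  also have "\<dots> = z" using relations_ef(3)[of 1] n F_z[of n] by (simp add: numeral_2_eq_2)
  finally show ?thesis by simp
qed

lemma z_E: "1 \<le> q \<Longrightarrow> z * E q = z"
  using E_E[of 1 q] n by (simp add: z_eq_f_e_1 E_def mult.assoc split: if_splits)

lemma z_a: "1 \<le> i \<Longrightarrow> i < n \<Longrightarrow> z * a i = z"
  using z_E[of i] relations_ae(4)[of i] by (metis E_def mult.assoc not_le)

lemma a_z:
  assumes "1 \<le> i" "i < n" shows "a i * z = z"
proof (cases "i = 1")
  case True
  have "a 1 * z = a 1 * f n * z" using F_z[of n] n by (simp add: F_def mult.assoc)
  also have "\<dots> = e 1 * (f n * z)" using relations_af(3) by (simp add: z_def mult.assoc)
  also have "\<dots> = z" using F_z[of n] E_z[of 1] n by (simp add: F_def E_def)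
  finally show ?thesis using True by simp
next
  case False
  then have "a i * E (i - 1) = E (i - 1)"
    using assms relations_ae(1)[of i] by (auto simp: E_def)
  then have "a i * (E (i - 1) * z) = E (i - 1) * z" by (simp add: mult.assoc[symmetric])
  then show ?thesis using False assms E_z[of "i - 1"] by simp
qed

lemma E_F_disjoint:
  assumes "1 \<le> q" "q < p" "p \<le> n"
  shows "E q * F p = z" "F p * E q = z"
proof -
  have Eq: "E q * F (q + 1) = z" "F (q + 1) * E q = z"
    using assms relations_ef(2,3)[of q] by (simp_all add: E_def F_def)
  have Fp: "F (q + 1) * F p = F p" "F p * F (q + 1) = F p"
    using assms F_F[of "q + 1" p] by auto
  have "E q * F p = E q * F (q + 1) * F p" using Fp by (simp add: mult.assoc)
  then show "E q * F p = z" using Eq z_F assms by simp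
  have "F p * E q = F p * (F (q + 1) * E q)" using Fp by (simp add: mult.assoc[symmetric])
  then show "F p * E q = z" using Eq F_z assms by simp
qed

subsection \<open>Moving the idempotents past the maps \<open>a\<^sub>i\<close>\<close>

lemma a_E_less:
  assumes "1 \<le> q" "q < i" "i < n" shows "a i * E q = E q"
proof -
  have "a i * E (i - 1) = E (i - 1)" using assms relations_ae(1)[of i] by (auto simp: E_def)
  then have "a i * (E (i - 1) * E q) = E (i - 1) * E q" by (simp add: mult.assoc[symmetric])
  then show ?thesis using assms E_E[of q "i - 1"] by simp
qed

lemma a_E_ge:
  assumes "1 \<le> i" "i \<le> q" "i < n" shows "a i * E q = E (Suc q) * a i"
proof -
  consider "q < n - 1" | "q = n - 1" | "n \<le> q" by linarith
  then show ?thesis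
  proof cases
    case 1
    then show ?thesis using assms relations_ae(2)[of i q] by (auto simp: E_def)
  next
    case 2
    \<comment> \<open>Here \<open>E (Suc q) = 1\<close>; the image of \<open>a\<^sub>i\<close> misses \<open>n\<close>, which \<open>a\<^sub>i a\<^sub>n\<^sub>-\<^sub>1 = a\<^sub>i\<close> expresses.\<close>
    have "a i * e (n - 1) = a i * a (n - 1) * e (n - 1)"
      using assms relations_a(1)[of i] by simp
    also have "\<dots> = a i" using assms relations_a(1)[of i] relations_ae(3) by (metis mult.assoc)
    finally show ?thesis using 2 n by (simp add: E_def)
  qed (simp add: E_def)
qed

lemma E_a:
  assumes "1 \<le> q" "q \<le> i" "i < n" shows "E q * a i = E q"
proof -
  have "E i * a i = E i" using assms relations_ae(4)[of i] by (simp add: E_def)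
  then have "E q * E i * a i = E q * E i" by (simp add: mult.assoc)
  then show ?thesis using assms E_E[of q i] by simp
qed

text \<open>
  On a domain that starts at \<open>p > i\<close>, the map \<open>a\<^sub>i\<close> is the translation by \<open>-1\<close>, whatever \<open>i\<close> is.
\<close>

lemma F_a:
  assumes "1 \<le> i" "i < p" "p \<le> n" shows "F p * a i = F p * a 1"
proof (cases "i = 1")
  case False
  have "F (i + 1) * a i = F (i + 1) * a 1"
    using False assms relations_af(5)[of i] by (simp add: F_def)
  then have "F p * F (i + 1) * a i = F p * F (i + 1) * a 1" by (simp add: mult.assoc)
  then show ?thesis using assms F_F[of "i + 1" p] by simp
qed simp

lemma a_F_le: "p \<le> i \<Longrightarrow> i < n \<Longrightarrow> a i * F p = F p * a i"
  using relations_af(1)[of p i] by (simp add: F_def)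

lemma a_F_less: "1 \<le> i \<Longrightarrow> i < p \<Longrightarrow> p < n \<Longrightarrow> a i * F p = F (Suc p) * a i"
  using relations_af(2)[of i p] by (simp add: F_def)

text \<open>
  Only the cases \<open>i = 1\<close> and \<open>i = n - 1\<close> are among the relations.  For the others, \<open>f\<^sub>n\<close> splits off
  \<open>f\<^sub>n\<^sub>-\<^sub>1\<close>, which becomes \<open>f\<^sub>n\<close> on passing \<open>a\<^sub>i\<close> and then turns \<open>a\<^sub>i\<close> into \<open>a\<^sub>1\<close>.
\<close>

lemma a_F_n:
  assumes "1 \<le> i" "i < n" shows "a i * F n = z"
proof (cases "i = n - 1")
  case True
  then show ?thesis using n relations_af(4) by (simp add: F_def)
next
  case False
  have "a i * F n = a i * F (n - 1) * F n"
    using F_F[of "n - 1" n] by (simp add: mult.assoc)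
  also have "\<dots> = F n * a i * F n"
    using False assms a_F_less[of i "n - 1"] by simp
  also have "\<dots> = F n * a 1 * F n" using F_a[of i n] assms by simp
  also have "\<dots> = z" using relations_af(3) F_z[of n] n by (simp add: F_def mult.assoc)
  finally show ?thesis .
qed

subsection \<open>Collecting the idempotents in front\<close>

text \<open>
  A set closed under multiplication on the left by the generators, hence containing every product
  of them.  The bound \<open>q\<close> may exceed \<open>n\<close>, so that passing an \<open>a\<^sub>i\<close> can always raise it by one.
\<close>

definition restricted_shifts :: "'m set" where
  "restricted_shifts = {z} \<union>
     {F p * E q * A js | p q js. 1 \<le> p \<and> p \<le> q \<and> p \<le> n \<and> set js \<subseteq> {1..<n}}"

lemma restricted_shiftsI:
  "1 \<le> p \<Longrightarrow> p \<le> q \<Longrightarrow> p \<le> n \<Longrightarrow> set js \<subseteq> {1..<n} \<Longrightarrow> F p * E q * A js \<in> restricted_shifts"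
  by (auto simp: restricted_shifts_def)

lemma z_A: "set js \<subseteq> {1..<n} \<Longrightarrow> z * A js = z"
  by (induction js) (auto simp: A_def mult.assoc[symmetric] z_a)

lemma z_in_restricted_shifts: "z \<in> restricted_shifts"
  by (simp add: restricted_shifts_def)

lemma a_mult_restricted_shift:
  assumes i: "1 \<le> i" "i < n" and pq: "1 \<le> p" "p \<le> q" "p \<le> n" and js: "set js \<subseteq> {1..<n}"
  shows "a i * (F p * E q * A js) \<in> restricted_shifts"
proof -
  have js': "set (i # js) \<subseteq> {1..<n}" using js i by auto
  have A: "A (i # js) = a i * A js" by (simp add: A_def)
  consider "p \<le> i" "i \<le> q" | "q < i" | "i < p" "p < n" | "i < p" "p = n"
    using pq by linarith
  then show ?thesis
  proof cases
    case 1
    have "a i * (F p * E q * A js) = (a i * F p) * E q * A js" by (simp add: mult.assoc)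
    also have "\<dots> = F p * (a i * E q) * A js" using 1 i by (simp add: a_F_le mult.assoc)
    also have "\<dots> = F p * E (Suc q) * A (i # js)" using 1 i by (simp add: a_E_ge A mult.assoc)
    finally show ?thesis using js' pq restricted_shiftsI[of p "Suc q" "i # js"] by simp
  next
    case 2
    have "a i * (F p * E q * A js) = (a i * F p) * E q * A js" by (simp add: mult.assoc)
    also have "\<dots> = F p * (a i * E q) * A js" using 2 i pq by (simp add: a_F_le mult.assoc)
    also have "\<dots> = F p * E q * A js" using 2 i pq by (simp add: a_E_less)
    finally show ?thesis using js pq restricted_shiftsI by simp
  next
    case 3
    have "a i * (F p * E q * A js) = (a i * F p) * E q * A js" by (simp add: mult.assoc)
    also have "\<dots> = F (Suc p) * (a i * E q) * A js" using 3 i by (simp add: a_F_less mult.assoc)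
    also have "\<dots> = F (Suc p) * E (Suc q) * A (i # js)"
      using 3 pq i by (simp add: a_E_ge A mult.assoc)
    finally show ?thesis using js' pq 3 restricted_shiftsI[of "Suc p" "Suc q" "i # js"] by simp
  next
    case 4
    have "a i * (F p * E q * A js) = (a i * F p) * E q * A js" by (simp add: mult.assoc)
    then show ?thesis using 4 i pq js by (simp add: a_F_n z_E z_A z_in_restricted_shifts)
  qed
qed

lemma F_mult_restricted_shift:
  assumes "j \<le> n" "1 \<le> p" "p \<le> q" "p \<le> n" "set js \<subseteq> {1..<n}"
  shows "F j * (F p * E q * A js) \<in> restricted_shifts"
proof -
  have "F j * F p = F (max j p)" using assms F_F[of j p] F_F[of p j] by (cases "j \<le> p") auto
  then have eq: "F j * (F p * E q * A js) = F (max j p) * E q * A js"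
    by (simp add: mult.assoc[symmetric])
  show ?thesis
  proof (cases "max j p \<le> q")
    case True
    then show ?thesis unfolding eq using assms by (intro restricted_shiftsI) auto
  next
    case False
    then show ?thesis unfolding eq using assms by (simp add: E_F_disjoint z_A z_in_restricted_shifts)
  qed
qed

lemma E_mult_restricted_shift:
  assumes "1 \<le> i" "1 \<le> p" "p \<le> q" "p \<le> n" "set js \<subseteq> {1..<n}"
  shows "E i * (F p * E q * A js) \<in> restricted_shifts"
proof (cases "p \<le> i")
  case True
  have "E i * E q = E (min i q)" using assms E_E[of i q] E_E[of q i] by (cases "i \<le> q") auto
  moreover have "E i * (F p * E q * A js) = F p * (E i * E q) * A js"
    using E_F_commute[OF True] by (metis mult.assoc)
  ultimately show ?thesis using True assms by (auto intro!: restricted_shiftsI)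
next
  case False
  then have "E i * F p = z" using assms by (intro E_F_disjoint) auto
  then have "E i * (F p * E q * A js) = z * E q * A js" by (simp add: mult.assoc[symmetric])
  then show ?thesis using assms by (simp add: z_E z_A z_in_restricted_shifts)
qed

lemma product_in_restricted_shifts:
  assumes "w \<in> lists (letters n)"
  shows "prod_list (map g w) \<in> restricted_shifts"
  using assms
proof induction
  case Nil
  have "1 = F 1 * E n * A []" by (simp add: F_def E_def A_def)
  then show ?case using restricted_shiftsI[of 1 n "[]"] n by simp
next
  case (Cons x w)
  let ?P = "prod_list (map g w)"
  note P = Cons.IH
  consider (a) i where "x = gen_a i" "1 \<le> i" "i < n" | (e) i where "x = gen_e i" "1 \<le> i" "i < n"
    | (f) j where "x = gen_f j" "2 \<le> j" "j \<le> n"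
    using Cons.hyps n by (auto simp: letters_A_def letters_E_def letters_F_def)
  note letter = this
  have "g x * ?P \<in> restricted_shifts"
  proof (cases "?P = z")
    case True
    have "g x * z = z"
      using letter
    proof cases
      case (a i)
      then show ?thesis using a_z by simp
    next
      case (e i)
      then show ?thesis using E_z[of i] by (simp add: E_def)
    next
      case (f j)
      then show ?thesis using F_z[of j] by (simp add: F_def)
    qed
    then show ?thesis using True z_in_restricted_shifts by simp
  next
    case False
    then obtain p q js where P: "?P = F p * E q * A js" "1 \<le> p" "p \<le> q" "p \<le> n" "set js \<subseteq> {1..<n}"
      using P by (auto simp: restricted_shifts_def)
    from letter show ?thesis
    proof cases
      case (a i)
      then show ?thesis using a_mult_restricted_shift P by simp
    next
      case (e i)
      then show ?thesis using E_mult_restricted_shift[of i] P by (simp add: E_def)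
    next
      case (f j)
      then show ?thesis using F_mult_restricted_shift[of j] P by (simp add: F_def)
    qed
  qed
  then show ?case by simp
qed

subsection \<open>Normalising the product of the maps \<open>a\<^sub>i\<close>\<close>

text \<open>
  Insertion of \<open>a\<^sub>i\<close> into a sorted product: either \<open>a\<^sub>i\<close> already belongs in front, or it passes the
  leading \<open>a\<^sub>j\<close>, whose index grows by one, unless \<open>j = n - 1\<close>, when \<open>a\<^sub>j\<close> disappears.  The bound \<open>m\<close> is
  carried through the induction because the result of inserting into the tail has to stay below
  the new leading index \<open>j + 1\<close>.
\<close>

lemma a_mult_decreasing:
  assumes "1 \<le> i" "i < n" "sorted_wrt (>) js" "set js \<subseteq> {1..<n}" "i \<le> m" "\<forall>j\<in>set js. j < m"
  shows "\<exists>js'. a i * A js = A js' \<and> sorted_wrt (>) js' \<and> set js' \<subseteq> {1..<n} \<and> (\<forall>j\<in>set js'. j \<le> m)"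
  using assms(3-)
proof (induction js arbitrary: m)
  case Nil
  then show ?case using assms(1,2) by (intro exI[of _ "[i]"]) (auto simp: A_def)
next
  case (Cons j js)
  show ?case
  proof (cases "j < i")
    case True
    then show ?thesis
      using Cons.prems assms(1,2) by (intro exI[of _ "i # j # js"]) (auto simp: A_def)
  next
    case False
    then obtain js' where js': "a i * A js = A js'" "sorted_wrt (>) js'" "set js' \<subseteq> {1..<n}"
        "\<forall>k\<in>set js'. k \<le> j"
      using Cons.IH[of j] Cons.prems by auto
    show ?thesis
    proof (cases "j = n - 1")
      case True
      have "a i * A (j # js) = (a i * a (n - 1)) * A js" using True by (simp add: A_def mult.assoc)
      then have "a i * A (j # js) = A js'" using relations_a(1)[of i] js' assms by simp
      then show ?thesis using js' Cons.prems by fastforce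
    next
      case not_last: False
      then have "j < n - 1" using Cons.prems by auto
      have "a i * A (j # js) = (a i * a j) * A js" by (simp add: A_def mult.assoc)
      also have "\<dots> = a (j + 1) * (a i * A js)"
        using relations_a(2)[of i j] False \<open>j < n - 1\<close> assms(1) by (simp add: mult.assoc[symmetric])
      also have "\<dots> = A ((j + 1) # js')" using js' by (simp add: A_def)
      finally show ?thesis
        using js' Cons.prems not_last by (intro exI[of _ "(j + 1) # js'"]) fastforce
    qed
  qed
qed

lemma A_decreasing:
  assumes "set js \<subseteq> {1..<n}"
  shows "\<exists>js'. A js = A js' \<and> sorted_wrt (>) js' \<and> set js' \<subseteq> {1..<n}"
  using assms
proof (induction js)
  case Nil
  then show ?case by (intro exI[of _ "[]"]) simp
next
  case (Cons i js)
  then obtain js' where js': "A js = A js'" "sorted_wrt (>) js'" "set js' \<subseteq> {1..<n}" by auto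
  have "A (i # js) = a i * A js'" using js' by (simp add: A_def)
  then show ?case
    using a_mult_decreasing[of i js' n] js' Cons.prems by fastforce
qed

text \<open>
  Since the indices decrease, those that are at least \<open>q\<close> stand next to \<open>e\<^sub>q\<close>, which absorbs them.
\<close>

lemma E_A_filter:
  assumes "1 \<le> q" "sorted_wrt (>) js" "set js \<subseteq> {1..<n}"
  shows "E q * A js = E q * A (filter (\<lambda>j. j < q) js)"
  using assms(2-)
proof (induction js)
  case (Cons j js)
  show ?case
  proof (cases "j < q")
    case True
    then have "filter (\<lambda>j. j < q) (j # js) = j # js" using Cons.prems by (auto simp: filter_id_conv)
    then show ?thesis by simp
  next
    case False
    then have "E q * A (j # js) = E q * A js"
      using E_a[of q j] Cons.prems assms(1) by (simp add: A_def mult.assoc[symmetric])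
    then show ?thesis using Cons False by simp
  qed
qed simp

lemma F_A_commute:
  assumes "set js \<subseteq> {p..<n}"
  shows "F p * A js = A js * F p"
  using assms
proof (induction js)
  case (Cons j js)
  have "F p * A (j # js) = a j * (F p * A js)"
    using Cons.prems a_F_le[of p j] by (simp add: A_def mult.assoc[symmetric])
  then show ?case using Cons by (simp add: A_def mult.assoc)
qed (simp add: A_def)

text \<open>
  The first factor acts on a domain starting at \<open>p\<close> and equals the translation \<open>a\<^sub>1\<close> there; moving
  \<open>f\<^sub>p\<close> past it lowers \<open>p\<close> by one.  The remaining indices are below \<open>p - 1\<close>, as they decrease, so
  the argument repeats.
\<close>

lemma F_A_below:
  assumes "1 \<le> p" "p \<le> n" "sorted_wrt (>) js" "set js \<subseteq> {1..<p}"
  shows "F p * A js = F p * a 1 ^ length js"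
  using assms
proof (induction js arbitrary: p)
  case (Cons j js)
  have 1: "F p * A (j # js) = F p * a 1 * A js"
    using F_a[of j p] Cons.prems by (simp add: A_def mult.assoc[symmetric])
  \<comment> \<open>\<open>F p * a 1 = a 1 * F (p - 1)\<close> fails for \<open>p = 2\<close>, where \<open>F 1 = 1\<close>; but then \<open>js\<close> is empty.\<close>
  show ?case
  proof (cases "p \<ge> 3")
    case True
    then have move: "F p * a 1 = a 1 * F (p - 1)" using a_F_less[of 1 "p - 1"] Cons.prems by simp
    have "F (p - 1) * A js = F (p - 1) * a 1 ^ length js"
      using Cons.prems True by (intro Cons.IH) fastforce+
    then show ?thesis using 1 move by (metis length_Cons mult.assoc power_Suc)
  next
    case False
    then have "js = []" using Cons.prems by (cases js) auto
    then show ?thesis using 1 by (simp add: A_def)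
  qed
qed (simp add: A_def)

lemma prod_normal_word:
  "prod_list (map g (normal_word n p q T k)) = F p * E q * A (rev (sorted_list_of_set T)) * a 1 ^ k"
proof -
  have "prod_list (replicate k (a 1)) = a 1 ^ k" by (induction k) auto
  then show ?thesis by (simp add: normal_word_def F_def E_def A_def mult.assoc comp_def)
qed

lemma restricted_shift_normal:
  assumes pq: "1 \<le> p" "p \<le> q" "q \<le> n" and js: "set js \<subseteq> {1..<n}"
  shows "\<exists>T k. T \<subseteq> {p..<q} \<and> k < p \<and>
    F p * E q * A js = F p * E q * A (rev (sorted_list_of_set T)) * a 1 ^ k"
proof -
  obtain ds where ds: "A js = A ds" "sorted_wrt (>) ds" "set ds \<subseteq> {1..<n}"
    using A_decreasing[OF js] by blast
  \<comment> \<open>Only the indices in \<open>{p..<q}\<close> collapse points of the domain; they form \<open>ts\<close>.\<close>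
  define us where "us = filter (\<lambda>j. j < q) ds"
  define ts where "ts = filter (\<lambda>j. p \<le> j) us"
  define bs where "bs = filter (\<lambda>j. j < p) us"
  have us: "sorted_wrt (>) us" using ds by (simp add: us_def sorted_wrt_filter)
  have ts: "sorted_wrt (>) ts" "set ts \<subseteq> {p..<q}" "set ts \<subseteq> {p..<n}"
    using us ds pq by (auto simp: ts_def us_def sorted_wrt_filter)
  have bs: "sorted_wrt (>) bs" "set bs \<subseteq> {1..<p}"
    using us ds by (auto simp: bs_def us_def sorted_wrt_filter)
  have "distinct bs"
    using bs(1) by (metis decreasing_list_eq_rev_sorted_list_of_set distinct_rev
        sorted_list_of_set.distinct_sorted_key_list_of_set)
  then have "length bs \<le> card {1..<p}"
    using bs(2) by (metis card_mono distinct_card finite_atLeastLessThan)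
  then have len: "length bs < p" using pq by simp
  have "us = ts @ bs" unfolding ts_def bs_def using us by (rule decreasing_list_split)
  then have split: "A us = A ts * A bs" by (simp add: A_def)
  \<comment> \<open>\<open>F p\<close> commutes with \<open>E q\<close> and \<open>A ts\<close>, so it can visit \<open>A bs\<close> and return.\<close>
  have "F p * E q * A js = F p * E q * (A ts * A bs)"
    using E_A_filter[of q ds] ds pq split by (simp add: us_def mult.assoc)
  also have "\<dots> = E q * (F p * A ts) * A bs"
    using E_F_commute[of p q] pq by (simp add: mult.assoc[symmetric])
  also have "\<dots> = E q * A ts * (F p * A bs)"
    using ts by (simp add: F_A_commute mult.assoc)
  also have "\<dots> = E q * A ts * (F p * a 1 ^ length bs)"
    using F_A_below[OF _ _ bs] pq by simp
  also have "\<dots> = E q * (F p * A ts) * a 1 ^ length bs"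
    using ts by (simp add: F_A_commute mult.assoc)
  also have "\<dots> = F p * E q * A ts * a 1 ^ length bs"
    using E_F_commute[of p q] pq by (simp add: mult.assoc[symmetric])
  finally have "F p * E q * A js = F p * E q * A ts * a 1 ^ length bs" .
  then show ?thesis
    using ts len decreasing_list_eq_rev_sorted_list_of_set[OF ts(1)] by metis
qed

theorem product_eq_normal_word:
  assumes "w \<in> lists (letters n)"
  shows "\<exists>v\<in>normal_words n. prod_list (map g w) = prod_list (map g v)"
proof (cases "prod_list (map g w) = z")
  case True
  then show ?thesis by (intro bexI[of _ "[gen_e 1, gen_f n]"]) (auto simp: normal_words_def z_def)
next
  case False
  then obtain p q js where w: "prod_list (map g w) = F p * E q * A js"
    and pq: "1 \<le> p" "p \<le> q" "p \<le> n" and js: "set js \<subseteq> {1..<n}"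
    using product_in_restricted_shifts[OF assms] by (auto simp: restricted_shifts_def)
  have Eq: "E q = E (min q n)" by (auto simp: E_def min_def)
  obtain T k where "T \<subseteq> {p..<min q n}" "k < p"
    "F p * E (min q n) * A js = F p * E (min q n) * A (rev (sorted_list_of_set T)) * a 1 ^ k"
    using restricted_shift_normal[of p "min q n" js] pq js by auto
  then have "prod_list (map g w) = prod_list (map g (normal_word n p (min q n) T k))"
    and "normal_word n p (min q n) T k \<in> normal_words n"
    using pq w Eq by (auto simp: prod_normal_word intro: normal_wordsI)
  then show ?thesis by blast
qed

end

section \<open>The transformations represented by the normal words\<close>

lemma mem_letters [simp]:
  "gen_a i \<in> letters_A n \<longleftrightarrow> 1 \<le> i \<and> i < n" "gen_a i \<notin> letters_E n" "gen_a i \<notin> letters_F n"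
  "gen_e i \<in> letters_E n \<longleftrightarrow> 1 \<le> i \<and> i < n" "gen_e i \<notin> letters_A n" "gen_e i \<notin> letters_F n"
  "gen_f j \<in> letters_F n \<longleftrightarrow> 2 \<le> j \<and> j \<le> n" "gen_f j \<notin> letters_A n" "gen_f j \<notin> letters_E n"
  by (auto simp: letters_A_def letters_E_def letters_F_def)

fun letter_map :: "nat \<Rightarrow> letter \<Rightarrow> nat \<rightharpoonup> nat" where
  "letter_map n (gen_a i) = (\<lambda>x. if x \<in> {1..n} then Some (if x \<le> i then x else x - 1) else None)"
| "letter_map n (gen_e i) = Some |` {1..i}"
| "letter_map n (gen_f i) = Some |` {i..n}"

primrec word_map :: "nat \<Rightarrow> letter list \<Rightarrow> nat \<rightharpoonup> nat" where
  "word_map n [] = Some |` {1..n}"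
| "word_map n (l # w) = word_map n w \<circ>\<^sub>m letter_map n l"

lemma word_map_outside: "w \<in> lists (letters n) \<Longrightarrow> x \<notin> {1..n} \<Longrightarrow> word_map n w x = None"
  by (induction w) (auto simp: letters_A_def letters_E_def letters_F_def restrict_map_def map_comp_def)

lemma word_map_append:
  assumes "v \<in> lists (letters n)"
  shows "word_map n (u @ v) = word_map n v \<circ>\<^sub>m word_map n u"
proof (induction u)
  case Nil
  show ?case
    using word_map_outside[OF assms] by (auto simp: fun_eq_iff map_comp_def restrict_map_def)
next
  case (Cons l u)
  then show ?case by (simp add: fun_eq_iff map_comp_def split: option.splits)
qed

lemma PIO_relations_words: "2 \<le> n \<Longrightarrow> set (PIO_relations n) \<subseteq> lists (letters n) \<times> lists (letters n)"
  unfolding PIO_relations_def R1_def R2_def R3_def R4_def R5_def R6_def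
  by (auto; linarith)

lemma word_map_relations:
  assumes "2 \<le> n"
  shows "(u, v) \<in> set (R1 n) \<Longrightarrow> word_map n u = word_map n v"
    and "(u, v) \<in> set (R2 n) \<Longrightarrow> word_map n u = word_map n v"
    and "(u, v) \<in> set (R3 n) \<Longrightarrow> word_map n u = word_map n v"
    and "(u, v) \<in> set (R4 n) \<Longrightarrow> word_map n u = word_map n v"
    and "(u, v) \<in> set (R5 n) \<Longrightarrow> word_map n u = word_map n v"
    and "(u, v) \<in> set (R6 n) \<Longrightarrow> word_map n u = word_map n v"
  using assms unfolding R1_def R2_def R3_def R4_def R5_def R6_def
  by (auto simp: fun_eq_iff map_comp_def restrict_map_def)

lemma word_map_PIO_relations:
  assumes "2 \<le> n" "(u, v) \<in> set (PIO_relations n)"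
  shows "word_map n u = word_map n v"
  using assms word_map_relations[OF assms(1)] by (auto simp: PIO_relations_def)

text \<open>
  The map with a given code subtracts from \<open>x\<close> the initial translation \<open>k\<close> and one for each
  collapse that occurs before \<open>x\<close>.
\<close>

definition shift :: "nat set \<Rightarrow> nat \<Rightarrow> nat \<Rightarrow> nat" where
  "shift T k x = x - card {t \<in> T. t < x} - k"

definition shift_map :: "nat \<Rightarrow> nat \<Rightarrow> nat set \<Rightarrow> nat \<Rightarrow> nat \<rightharpoonup> nat" where
  "shift_map p q T k = (\<lambda>x. Some (shift T k x)) |` {p..q}"

text \<open>
  If \<open>x\<close> exceeds the leading index \<open>j\<close>, then \<open>a\<^sub>j\<close> sends it to \<open>x - 1 \<ge> j\<close>, still above all
  remaining indices; so exactly the indices below the original \<open>x\<close> lower it.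
\<close>

lemma word_map_decreasing:
  assumes "sorted_wrt (>) js" "set js \<subseteq> {1..<n}" "x \<in> {1..n}"
  shows "word_map n (map gen_a js @ w) x = word_map n w (x - length (filter (\<lambda>j. j < x) js))"
  using assms
proof (induction js arbitrary: x)
  case (Cons j js)
  show ?case
  proof (cases "x \<le> j")
    case True
    then show ?thesis using Cons by (simp add: map_comp_def)
  next
    case False
    then have "filter (\<lambda>i. i < x - 1) js = js" "filter (\<lambda>i. i < x) js = js"
      using Cons.prems by (fastforce simp: filter_id_conv)+
    moreover have "x - 1 \<in> {1..n}" using Cons.prems False by auto
    ultimately show ?thesis using Cons.IH[of "x - 1"] Cons.prems False by (simp add: map_comp_def)
  qed
qed simp

lemma word_map_replicate:
  assumes "2 \<le> n" "k < x" "x \<le> n"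
  shows "word_map n (replicate k (gen_a 1)) x = Some (x - k)"
  using assms by (induction k arbitrary: x) (auto simp: map_comp_def restrict_map_def)

lemma card_below_Suc:
  fixes T :: "nat set"
  assumes "finite T"
  shows "card {t \<in> T. t < Suc x} = card {t \<in> T. t < x} + (if x \<in> T then 1 else 0)"
proof -
  have "{t \<in> T. t < Suc x} = (if x \<in> T then insert x {t \<in> T. t < x} else {t \<in> T. t < x})"
    by (auto simp: less_Suc_eq)
  then show ?thesis using assms by simp
qed

context
  fixes p q k :: nat and T :: "nat set"
  assumes T: "T \<subseteq> {p..<q}" and k: "k < p"
begin

lemma card_below_le: "p \<le> x \<Longrightarrow> p + card {t \<in> T. t < x} \<le> x"
  using card_mono[of "{p..<x}" "{t \<in> T. t < x}"] T by fastforce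

lemma shift_start: "shift T k p = p - k"
proof -
  have "{t \<in> T. t < p} = {}" using T by auto
  then have c: "card {t \<in> T. t < p} = 0" by (simp only: card.empty)
  show ?thesis unfolding shift_def c by simp
qed

lemma shift_Suc: "p \<le> x \<Longrightarrow> shift T k (Suc x) = shift T k x + (if x \<in> T then 0 else 1)"
  using card_below_le[of x] card_below_Suc[of T x] finite_subset[OF T] k
  by (auto simp: shift_def)

lemma shift_mono:
  assumes "p \<le> x" "x \<le> y"
  shows "shift T k x \<le> shift T k y"
  using assms(2,1) by (induction y rule: dec_induct) (auto simp: shift_Suc)

text \<open>
  Steps of height at most one leave no gap in the image, by the discrete intermediate value theorem.
\<close>

lemma ran_shift_map: "p \<le> q \<Longrightarrow> ran (shift_map p q T k) = {p - k..shift T k q}"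
proof (intro equalityI subsetI)
  fix y assume "p \<le> q" "y \<in> {p - k..shift T k q}"
  then have "\<exists>i. p \<le> i \<and> i \<le> q \<and> int (shift T k i) = int y"
    using shift_start by (intro nat_intermed_int_val) (auto simp: shift_Suc)
  then show "y \<in> ran (shift_map p q T k)"
    by (auto simp: ran_def shift_map_def restrict_map_def)
next
  fix y assume "p \<le> q" "y \<in> ran (shift_map p q T k)"
  then show "y \<in> {p - k..shift T k q}"
    using shift_start shift_mono
    by (fastforce simp: ran_def shift_map_def restrict_map_def split: if_splits)
qed

lemma shift_map_in_PIO_decreasing:
  assumes "1 \<le> p" "p \<le> q" "q \<le> n"
  shows "shift_map p q T k \<in> carrier (PIO_decreasing n)"
proof -
  have dom: "dom (shift_map p q T k) = {p..q}" by (auto simp: shift_map_def)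
  have le: "shift T k x \<le> x" for x by (simp add: shift_def)
  have "interval_of n {p..q}" using assms by (auto simp: interval_of_def)
  moreover have "interval_of n {p - k..shift T k q}"
    using assms k le[of q] by (auto simp: interval_of_def)
  moreover have "order_preserving (shift_map p q T k)"
    unfolding order_preserving_def dom
    by (intro mono_onI) (auto simp: shift_map_def intro: shift_mono)
  moreover have "order_decreasing (shift_map p q T k)"
    unfolding order_decreasing_def dom using le by (auto simp: shift_map_def)
  ultimately show ?thesis
    using assms by (simp add: PIO_decreasing_def PIO_def dom ran_shift_map)
qed

lemma normal_word_in_lists:
  assumes "1 \<le> p" "p \<le> q" "q \<le> n"
  shows "normal_word n p q T k \<in> lists (letters n)"
proof -
  have "finite T" using finite_subset[OF T] by simp
  moreover have "1 \<le> t \<and> t < n" if "t \<in> T" for t using that T assms by force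
  ultimately show ?thesis
    using assms k
    by (auto simp: normal_word_def)
qed

lemma word_map_normal_word:
  assumes n: "2 \<le> n" and pq: "1 \<le> p" "p \<le> q" "q \<le> n"
  shows "word_map n (normal_word n p q T k) = shift_map p q T k"
proof
  fix x
  have fin: "finite T" using finite_subset[OF T] by simp
  let ?js = "rev (sorted_list_of_set T)"
  let ?w = "map gen_a ?js @ replicate k (gen_a 1)"
  show "word_map n (normal_word n p q T k) x = shift_map p q T k x"
  proof (cases "x \<in> {p..q}")
    case True
    have "length (filter (\<lambda>j. j < x) ?js) = card {t \<in> T. t < x}"
      using fin by (subst distinct_card[symmetric]) (auto intro: arg_cong[where f = card])
    moreover have "sorted_wrt (>) ?js"
      using fin by (simp add: sorted_wrt_rev)
    moreover have "set ?js \<subseteq> {1..<n}" using T pq fin by auto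
    ultimately have "word_map n ?w x = word_map n (replicate k (gen_a 1)) (x - card {t \<in> T. t < x})"
      using True pq by (subst word_map_decreasing) auto
    also have "\<dots> = Some (shift T k x)"
      using True card_below_le[of x] k pq n by (subst word_map_replicate) (auto simp: shift_def)
    finally show ?thesis
      using True pq by (auto simp: normal_word_def map_comp_def shift_map_def)
  next
    case False
    have "word_map n (normal_word n p q T k) x = None"
    proof (cases "x \<in> {1..n}")
      case inside: True
      then show ?thesis using False pq by (auto simp: normal_word_def map_comp_def restrict_map_def)
    next
      case False
      then show ?thesis using word_map_outside[OF normal_word_in_lists[OF pq]] by simp
    qed
    then show ?thesis using False by (simp add: shift_map_def)
  qed
qed

lemma shift_map_determines_T:
  "p \<le> q \<Longrightarrow> T = {t \<in> {p..<q}. shift_map p q T k (Suc t) = shift_map p q T k t}"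
  using T by (auto simp: shift_map_def shift_Suc split: if_splits)

end

text \<open>
  The domain gives \<open>p\<close> and \<open>q\<close>, the value at \<open>p\<close> gives \<open>k\<close>, and the constant steps give \<open>T\<close>.
\<close>

lemma shift_map_inject:
  assumes eq: "shift_map p q T k = shift_map p' q' T' k'"
    and "p \<le> q" "T \<subseteq> {p..<q}" "k < p" and "p' \<le> q'" "T' \<subseteq> {p'..<q'}" "k' < p'"
  shows "p = p' \<and> q = q' \<and> T = T' \<and> k = k'"
proof -
  have "dom (shift_map p q T k) = {p..q}" "dom (shift_map p' q' T' k') = {p'..q'}"
    by (auto simp: shift_map_def)
  then have pq: "p = p'" "q = q'" using eq assms(2,5) by (auto simp: Icc_eq_Icc)
  have "shift T k p = shift T' k' p"
    using eq assms(2) pq by (auto simp: shift_map_def restrict_map_def fun_eq_iff split: if_splits)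
  then have "k = k'" using shift_start[OF assms(3,4)] shift_start[OF assms(6,7)] assms pq by simp
  moreover have "T = T'"
  proof -
    have "T = {t \<in> {p..<q}. shift_map p q T k (Suc t) = shift_map p q T k t}"
      by (rule shift_map_determines_T[OF assms(3,4,2)])
    also have "\<dots> = {t \<in> {p'..<q'}. shift_map p' q' T' k' (Suc t) = shift_map p' q' T' k' t}"
      unfolding eq unfolding pq ..
    also have "\<dots> = T'"
      by (rule shift_map_determines_T[OF assms(6,7,5), symmetric])
    finally show ?thesis .
  qed
  ultimately show ?thesis using pq by simp
qed

lemma word_map_zero: "2 \<le> n \<Longrightarrow> word_map n [gen_e 1, gen_f n] = Map.empty"
  by (auto simp: fun_eq_iff map_comp_def restrict_map_def)

lemma normal_words_subset:
  assumes "2 \<le> n"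
  shows "normal_words n \<subseteq> lists (letters n)"
proof -
  have "[gen_e 1, gen_f n] \<in> lists (letters n)" using assms by simp
  then show ?thesis unfolding normal_words_def using normal_word_in_lists by blast
qed

lemma inj_on_normal_words:
  assumes "2 \<le> n"
  shows "inj_on (word_map n) (normal_words n)"
proof (rule inj_onI)
  fix u v assume uv: "u \<in> normal_words n" "v \<in> normal_words n" "word_map n u = word_map n v"
  have nonempty: "shift_map p q T k \<noteq> Map.empty" if "p \<le> q" for p q T k
    using that by (auto simp: shift_map_def fun_eq_iff restrict_map_def)
  have zero_or_shift: "w = [gen_e 1, gen_f n] \<and> word_map n w = Map.empty \<or>
    (\<exists>p q T k. w = normal_word n p q T k \<and> word_map n w = shift_map p q T k \<and>
      p \<le> q \<and> T \<subseteq> {p..<q} \<and> k < p)" if "w \<in> normal_words n" for w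
    using that unfolding normal_words_def
  proof (elim UnE CollectE exE conjE)
    assume "w \<in> {[gen_e 1, gen_f n]}"
    then show ?thesis using word_map_zero[OF assms] by simp
  next
    fix p q T k assume "w = normal_word n p q T k" "1 \<le> p" "p \<le> q" "q \<le> n" "T \<subseteq> {p..<q}" "k < p"
    then show ?thesis using word_map_normal_word[of T p q k n] assms by blast
  qed
  show "u = v"
    using zero_or_shift[OF uv(1)]
  proof (elim disjE conjE exE)
    assume u: "u = [gen_e 1, gen_f n]" "word_map n u = Map.empty"
    then show ?thesis using zero_or_shift[OF uv(2)] uv(3) nonempty by metis
  next
    fix p q T k
    assume u: "u = normal_word n p q T k" "word_map n u = shift_map p q T k"
      "p \<le> q" "T \<subseteq> {p..<q}" "k < p"
    then have "word_map n v \<noteq> Map.empty" using uv(3) nonempty by metis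
    then obtain p' q' T' k' where "v = normal_word n p' q' T' k'"
      "word_map n v = shift_map p' q' T' k'" "p' \<le> q'" "T' \<subseteq> {p'..<q'}" "k' < p'"
      using zero_or_shift[OF uv(2)] by blast
    then show ?thesis using u uv(3) shift_map_inject[of p q T k p' q' T' k'] by simp
  qed
qed

lemma interval_ofD:
  assumes "interval_of n I" "x \<in> I" "z \<in> I" "x \<le> y" "y \<le> z"
  shows "y \<in> I"
proof -
  have "I \<subseteq> {1..n}" using assms(1) by (simp add: interval_of_def)
  then have "x \<in> {1..n}" "z \<in> {1..n}" "y \<in> {1..n}" using assms(2-5) by auto
  then show ?thesis using assms unfolding interval_of_def by blast
qed

text \<open>
  The code is read off the map \<open>\<alpha>\<close>.  A step of height two or more would skip a value, which no other
  argument can take by monotonicity, so the image would have a gap.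
\<close>

lemma PIO_decreasing_shift_map:
  assumes \<alpha>: "\<alpha> \<in> carrier (PIO_decreasing n)" and "\<alpha> \<noteq> Map.empty"
  shows "\<exists>p q T k. 1 \<le> p \<and> p \<le> q \<and> q \<le> n \<and> T \<subseteq> {p..<q} \<and> k < p \<and> \<alpha> = shift_map p q T k"
proof -
  define h where "h x = the (\<alpha> x)" for x
  have \<alpha>_props: "interval_of n (dom \<alpha>)" "interval_of n (ran \<alpha>)" "order_preserving \<alpha>"
      "order_decreasing \<alpha>"
    using \<alpha> by (auto simp: PIO_decreasing_def PIO_def)
  have sub: "dom \<alpha> \<subseteq> {1..n}" "ran \<alpha> \<subseteq> {1..n}" using \<alpha>_props by (auto simp: interval_of_def)
  have fin: "finite (dom \<alpha>)" using sub finite_subset by blast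
  have ne: "dom \<alpha> \<noteq> {}" using assms(2) by auto
  define p where "p = Min (dom \<alpha>)"
  define q where "q = Max (dom \<alpha>)"
  have in_dom: "p \<in> dom \<alpha>" "q \<in> dom \<alpha>" using fin ne by (auto simp: p_def q_def)
  have bounds: "p \<le> x" "x \<le> q" if "x \<in> dom \<alpha>" for x
    using fin that by (auto simp: p_def q_def)
  have pq: "1 \<le> p" "p \<le> q" "q \<le> n" using in_dom sub bounds by auto
  have dom: "dom \<alpha> = {p..q}"
  proof (intro equalityI subsetI)
    fix y assume y: "y \<in> {p..q}"
    then show "y \<in> dom \<alpha>" using interval_ofD[OF \<alpha>_props(1) in_dom] by simp
  qed (use bounds in auto)
  have \<alpha>_h: "\<alpha> x = Some (h x)" if "x \<in> {p..q}" for x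
  proof -
    have "x \<in> dom \<alpha>" using that dom by simp
    then show ?thesis by (auto simp: h_def)
  qed
  have mono: "h x \<le> h y" if "p \<le> x" "x \<le> y" "y \<le> q" for x y
    using \<alpha>_props(3) that unfolding order_preserving_def dom h_def mono_on_def by simp
  have decr: "h x \<le> x" if "x \<in> {p..q}" for x
    using \<alpha>_props(4) that unfolding order_decreasing_def dom h_def by blast
  have in_ran: "h x \<in> ran \<alpha>" if "x \<in> {p..q}" for x
    using \<alpha>_h[OF that] by (rule ranI)
  have pos: "1 \<le> h x" if "x \<in> {p..q}" for x
    using in_ran[OF that] sub(2) by auto
  have step: "h (Suc x) \<le> Suc (h x)" if x: "p \<le> x" "x < q" for x
  proof (rule ccontr)
    assume "\<not> h (Suc x) \<le> Suc (h x)"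
    moreover have "h x \<in> ran \<alpha>" "h (Suc x) \<in> ran \<alpha>" using in_ran x by auto
    ultimately have "Suc (h x) \<in> ran \<alpha>"
      using interval_ofD[OF \<alpha>_props(2), of "h x" "h (Suc x)" "Suc (h x)"] by simp
    then obtain y where "\<alpha> y = Some (Suc (h x))" by (auto simp: ran_def)
    then have y: "y \<in> {p..q}" "h y = Suc (h x)" using dom by (auto simp: h_def)
    show False
    proof (cases "y \<le> x")
      case True
      then show False using mono[of y x] y x by auto
    next
      case False
      then show False using mono[of "Suc x" y] y x \<open>\<not> h (Suc x) \<le> Suc (h x)\<close> by auto
    qed
  qed
  define T where "T = {t \<in> {p..<q}. h (Suc t) = h t}"
  define k where "k = p - h p"
  have T: "T \<subseteq> {p..<q}" by (auto simp: T_def)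
  have k: "k < p" using pos[of p] pq by (simp add: k_def)
  have "h x = shift T k x" if "p \<le> x" "x \<le> q" for x
    using that
  proof (induction x rule: dec_induct)
    case base
    show ?case using shift_start[OF T k] decr[of p] pq by (simp add: k_def)
  next
    case (step x)
    then have "h (Suc x) = h x + (if x \<in> T then 0 else 1)"
      using mono[of x "Suc x"] \<open>\<And>x. p \<le> x \<Longrightarrow> x < q \<Longrightarrow> h (Suc x) \<le> Suc (h x)\<close>[of x]
      by (auto simp: T_def)
    then show ?case using step shift_Suc[OF T k, of x] by simp
  qed
  then have "\<alpha> x = shift_map p q T k x" for x
    using \<alpha>_h dom by (cases "x \<in> {p..q}") (auto simp: shift_map_def)
  then show ?thesis using pq T k by blast
qed

lemma word_map_image:
  assumes n: "2 \<le> n"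
  shows "word_map n ` normal_words n = carrier (PIO_decreasing n)"
proof (intro equalityI subsetI)
  fix \<alpha> assume "\<alpha> \<in> word_map n ` normal_words n"
  moreover have "Map.empty \<in> carrier (PIO_decreasing n)"
    by (simp add: PIO_decreasing_def PIO_def interval_of_def order_preserving_def
        order_decreasing_def mono_on_def)
  ultimately show "\<alpha> \<in> carrier (PIO_decreasing n)"
    using word_map_zero[OF n] word_map_normal_word[OF _ _ n] shift_map_in_PIO_decreasing
    by (force simp: normal_words_def simp del: word_map.simps)
next
  fix \<alpha> assume \<alpha>: "\<alpha> \<in> carrier (PIO_decreasing n)"
  show "\<alpha> \<in> word_map n ` normal_words n"
  proof (cases "\<alpha> = Map.empty")
    case True
    then show ?thesis using word_map_zero[OF n]
      by (intro image_eqI[of _ _ "[gen_e 1, gen_f n]"]) (simp_all add: normal_words_def)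
  next
    case False
    then obtain p q T k where "1 \<le> p" "p \<le> q" "q \<le> n" "T \<subseteq> {p..<q}" "k < p" "\<alpha> = shift_map p q T k"
      using PIO_decreasing_shift_map[OF \<alpha>] by blast
    then show ?thesis
      using word_map_normal_word[OF _ _ n]
      by (intro image_eqI[of _ _ "normal_word n p q T k"]) (auto intro: normal_wordsI)
  qed
qed

theorem PIO_decreasing_presentation:
  assumes n: "2 \<le> n"
  shows "defined_by_presentation (PIO_decreasing n) (letters n) (PIO_relations n)"
proof (rule presentation_criterion[where \<phi> = "word_map n" and N = "normal_words n"])
  let ?C = "generated_congruence (free_monoid (letters n)) (set (PIO_relations n))"
  let ?g = "letter_action (letters n) ?C"
  have C: "congruence_on (free_monoid (letters n)) ?C"
    using PIO_relations_words[OF n] by (rule congruence_on_word_congruence)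
  interpret PIO_letters n ?g
  proof
    fix u v assume uv: "(u, v) \<in> set (PIO_relations n)"
    then have "(u, v) \<in> ?C" using subset_generated_congruence by blast
    moreover have "u \<in> lists (letters n)" "v \<in> lists (letters n)"
      using uv PIO_relations_words[OF n] by blast+
    ultimately show "prod_list (map ?g u) = prod_list (map ?g v)"
      using word_action_eq_iff[OF C] by blast
  qed (rule n)
  show "\<exists>v\<in>normal_words n. (w, v) \<in> ?C" if w: "w \<in> lists (letters n)" for w
    using product_eq_normal_word[OF w] word_action_eq_iff[OF C w] normal_words_subset[OF n] by blast
  show "word_map n (u @ v) = word_map n u \<otimes>\<^bsub>PIO_decreasing n\<^esub> word_map n v"
    if "v \<in> lists (letters n)" for u v
    using word_map_append[OF that] by (simp add: PIO_decreasing_def PIO_def)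
qed (use n in \<open>simp_all add: PIO_relations_words word_map_PIO_relations normal_words_subset
    inj_on_normal_words word_map_image\<close>)

section \<open>The number of generators and of relations\<close>

lemma card_letters: "2 \<le> n \<Longrightarrow> card (letters n) = 3 * n - 3"
proof -
  assume n: "2 \<le> n"
  have "card (letters_A n) = n - 1" "card (letters_E n) = n - 1" "card (letters_F n) = n - 1"
    by (simp_all add: letters_A_def letters_E_def letters_F_def card_image inj_on_def)
  moreover have "letters_A n \<inter> letters_E n = {}" "(letters_A n \<union> letters_E n) \<inter> letters_F n = {}"
    "finite (letters_A n)" "finite (letters_E n)" "finite (letters_F n)"
    by (auto simp: letters_A_def letters_E_def letters_F_def)
  ultimately show ?thesis using n by (simp add: card_Un_disjoint)
qed

text \<open>
  The number of pairs \<open>i \<le> j\<close> in the doubly indexed families of relations, for either order of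
  the two indices.
\<close>

lemma sum_triangle:
  "2 * (\<Sum>i\<leftarrow>[1..<m]. m - i) = m * (m - 1)"
  "2 * (\<Sum>i\<leftarrow>[2..<Suc m]. i - 1) = m * (m - 1)"
proof -
  have "2 * (\<Sum>i\<leftarrow>[1..<Suc m]. Suc m - i) = Suc m * m" for m
  proof (induction m)
    case (Suc m)
    have "(\<Sum>i\<leftarrow>[1..<Suc (Suc m)]. Suc (Suc m) - i) = (\<Sum>i\<in>{1..<Suc m}. Suc (Suc m) - i) + 1"
      by (simp add: interv_sum_list_conv_sum_set_nat del: upt_Suc)
    also have "(\<Sum>i\<in>{1..<Suc m}. Suc (Suc m) - i) = (\<Sum>i\<in>{1..<Suc m}. (Suc m - i) + 1)"
      by (intro sum.cong) auto
    also have "\<dots> = (\<Sum>i\<leftarrow>[1..<Suc m]. Suc m - i) + m"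
      by (simp add: sum_Suc interv_sum_list_conv_sum_set_nat del: upt_Suc sum.op_ivl_Suc)
    finally show ?case using Suc.IH by simp
  qed simp
  then show "2 * (\<Sum>i\<leftarrow>[1..<m]. m - i) = m * (m - 1)" by (cases m) (simp_all del: upt_Suc)
  show "2 * (\<Sum>i\<leftarrow>[2..<Suc m]. i - 1) = m * (m - 1)"
  proof (induction m)
    case (Suc m)
    then show ?case by (cases m) simp_all
  qed simp
qed

lemma length_PIO_relations:
  assumes "2 \<le> n"
  shows "2 * int (length (PIO_relations n)) = 5 * (int n)\<^sup>2 + 9 * int n - 20"
proof -
  obtain m where m: "n = Suc (Suc m)" using le_Suc_ex[OF assms] by auto
  let ?t = "\<Sum>i\<leftarrow>[1..<Suc m]. Suc m - i"
  have t: "2 * ?t = Suc m * m" "(\<Sum>i\<leftarrow>[2..<n]. i - 1) = ?t"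
    using sum_triangle[of "Suc m"] by (simp_all add: m del: upt_Suc)
  \<comment> \<open>The outer index of one family runs up to \<open>n - 1\<close>, where the inner range is empty.\<close>
  have t': "(\<Sum>i\<leftarrow>[1..<Suc (Suc m)]. Suc m - i) = ?t"
    by (subst upt_Suc_append) (simp_all del: upt_Suc)
  have len: "length (R1 n) = Suc m + ?t" "length (R2 n) = 2 * Suc m"
    "length (R3 n) = ?t + 2 * Suc m + 4 * m" "length (R4 n) = 2 * m + 2 + ?t"
    "length (R5 n) = 2 * ?t + 2" "length (R6 n) = m"
    using t(2) t'
    by (simp_all add: R1_def R2_def R3_def R4_def R5_def R6_def length_concat comp_def m
        del: upt_Suc)
  have "2 * length (PIO_relations n) = 5 * (2 * ?t) + 2 * (12 * m + 9)"
    unfolding PIO_relations_def by (simp add: len del: upt_Suc)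
  also have "\<dots> = 5 * (Suc m * m) + 2 * (12 * m + 9)" by (simp only: t(1))
  finally have "2 * int (length (PIO_relations n)) = int (5 * (Suc m * m) + 2 * (12 * m + 9))"
    by (metis of_nat_mult of_nat_numeral)
  then show ?thesis by (simp add: m power2_eq_square algebra_simps)
qed

theorem theorem22:
  fixes n :: nat
  assumes "n \<ge> 2"
  shows "defined_by_presentation (PIO_decreasing n)
           (letters_A n \<union> letters_E n \<union> letters_F n) (PIO_relations n)
       \<and> card (letters_A n \<union> letters_E n \<union> letters_F n) = 3 * n - 3
       \<and> 2 * int (length (PIO_relations n)) = 5 * (int n)\<^sup>2 + 9 * int n - 20"
  using PIO_decreasing_presentation[OF assms] card_letters[OF assms] length_PIO_relations[OF assms]
  by blast

end
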